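(* Let $z$ be a real quadratic irrational with expansions $z=\lfloor a_0,a_1,\ldots,a_q,\overline{b_1,\ldots,b_l}\rfloor=\lceil c_0,c_1,\ldots,c_r,\overline{d_1,\ldots,d_m}\rceil$, where $l,m$ are smallest possible and, for these, $q,r$ are smallest possible ($q=-1$, resp. $r=-1$, in the purely periodic case). Let $L=l$ if $l$ is even and $L=2l$ if $l$ is odd, with $b_{l+j}=b_j$, and assume $B:=(-1)^q\sum_{j=1}^L(-1)^{j-1}b_j=0$ (equivalently, $\frac1m\sum_{j=1}^m d_j=3$). Put $A=\sum_{k=0}^q(-1)^{k-1}a_k$ and $C=\sum_{j=0}^r(3-c_j)$ (both $0$ in the purely periodic case). For $h=1,\ldots,L$ let $u_h=\lfloor\overline{b_h,b_{h-1},\ldots,b_1,b_L,b_{L-1},\ldots,b_{h+1}}\rfloor$ and $$U_h=A+(-1)^q\sum_{k=1}^h(-1)^{k-1}b_k+\begin{cases} z+1/u_h-3 & \text{if } q+h \text{ is odd},\\ z-1/u_h & \text{if } q+h\text{ is even}.\end{cases}$$ For $i=1,\ldots,m$ let $v_i=\lceil\overline{d_i,d_{i-1},\ldots,d_1,d_m,d_{m-1},\ldots,d_{i+1}}\rceil$ and $$V_i=C+\sum_{j=1}^i(3-d_j)+z-1/v_i-3.$$ Let $i\in\{1,\ldots,m\}$ be such that $d_{i+1}\ge 3$ (where for $i=m$ this means $d_1\ge 3$). Then $V_i=U_h$ for some $h\in\{1,\ldots,L\}$ with $q+h$ odd. Moreover, if $h\in\{1,\ldots,L\}$ with $q+h$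 even, then $U_h\neq V_i$ for all $i\in\{1,\ldots,m\}$.
   Context: The regular continued fraction expansion $\lfloor a_0,a_1,\ldots\rfloor$ means $a_0+1/(a_1+1/(a_2+\cdots))$, obtained by $z_0=z$, $a_0=\lfloor z_0\rfloor$, $z_{j+1}=1/(z_j-a_j)$, $a_{j+1}=\lfloor z_{j+1}\rfloor$; an overline denotes a repeating period. The negative regular expansion $\lceil c_0,c_1,\ldots\rceil$ means $c_0-1/(c_1-1/(c_2-\cdots))$, obtained by $z_0=z$, $c_0=\lceil z_0\rceil$, $z_{j+1}=1/(c_j-z_j)$, $c_{j+1}=\lceil z_{j+1}\rceil$. (In the paper, the $U_h$ are the cluster points of the Dedekind sums $S(p_k,q_k)$ of the regular convergents and the $V_i$ those of $S(s_j,t_j)$ of the negative regular convergents, when $B=0$.) *)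

theory Defs
  imports Complex_Main
begin

definition quadratic_irrational :: "real \<Rightarrow> bool" where
  "quadratic_irrational z \<longleftrightarrow> z \<notin> \<rat> \<and>
     (\<exists>a b c :: int. a \<noteq> 0 \<and> of_int a * z\<^sup>2 + of_int b * z + of_int c = 0)"

text \<open>The two expansion algorithms. They never divide by zero when started at an irrational number.\<close>

primrec reg_rem :: "real \<Rightarrow> nat \<Rightarrow> real" where
  "reg_rem z 0 = z"
| "reg_rem z (Suc j) = 1 / (reg_rem z j - of_int \<lfloor>reg_rem z j\<rfloor>)"

definition reg_coeff :: "real \<Rightarrow> nat \<Rightarrow> int" where
  "reg_coeff z j = \<lfloor>reg_rem z j\<rfloor>"

primrec neg_rem :: "real \<Rightarrow> nat \<Rightarrow> real" where
  "neg_rem z 0 = z"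
| "neg_rem z (Suc j) = 1 / (of_int \<lceil>neg_rem z j\<rceil> - neg_rem z j)"

definition neg_coeff :: "real \<Rightarrow> nat \<Rightarrow> int" where
  "neg_coeff z j = \<lceil>neg_rem z j\<rceil>"

text \<open>Values of infinite continued fractions, as limits of the finite ones
  \<open>s 0 + 1/(s 1 + \<dots> + 1/s n)\<close> and \<open>s 0 - 1/(s 1 - \<dots> - 1/s n)\<close>.\<close>

primrec reg_conv :: "nat \<Rightarrow> (nat \<Rightarrow> int) \<Rightarrow> real" where
  "reg_conv 0 s = of_int (s 0)"
| "reg_conv (Suc n) s = of_int (s 0) + 1 / reg_conv n (\<lambda>k. s (Suc k))"

definition reg_value :: "(nat \<Rightarrow> int) \<Rightarrow> real" where
  "reg_value s = lim (\<lambda>n. reg_conv n s)"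

primrec neg_conv :: "nat \<Rightarrow> (nat \<Rightarrow> int) \<Rightarrow> real" where
  "neg_conv 0 s = of_int (s 0)"
| "neg_conv (Suc n) s = of_int (s 0) - 1 / neg_conv n (\<lambda>k. s (Suc k))"

definition neg_value :: "(nat \<Rightarrow> int) \<Rightarrow> real" where
  "neg_value s = lim (\<lambda>n. neg_conv n s)"

text \<open>The sequence consisting of the preperiod \<open>xs\<close> followed by \<open>ys\<close> repeated forever.\<close>

definition periodic_seq :: "'a list \<Rightarrow> 'a list \<Rightarrow> nat \<Rightarrow> 'a" where
  "periodic_seq xs ys n =
     (if n < length xs then xs ! n else ys ! ((n - length xs) mod length ys))"

text \<open>The period is as short as possible and, for that period length, so is the preperiod.\<close>

definition shortest_periodic_form :: "(nat \<Rightarrow> 'a) \<Rightarrow> 'a list \<Rightarrow> 'a list \<Rightarrow> bool" where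
  "shortest_periodic_form s xs ys \<longleftrightarrow>
     ys \<noteq> [] \<and> s = periodic_seq xs ys \<and>
     (\<forall>xs' ys'. ys' \<noteq> [] \<and> s = periodic_seq xs' ys' \<longrightarrow>
        length ys \<le> length ys' \<and> (length ys' = length ys \<longrightarrow> length xs \<le> length xs'))"

text \<open>Below, \<open>as = [a\<^sub>0, \<dots>, a\<^sub>q]\<close>, \<open>bs = [b\<^sub>1, \<dots>, b\<^sub>l]\<close>, \<open>cs = [c\<^sub>0, \<dots>, c\<^sub>r]\<close>,
  \<open>ds = [d\<^sub>1, \<dots>, d\<^sub>m]\<close>. An empty preperiod corresponds to \<open>q = -1\<close> or \<open>r = -1\<close>, so
  \<open>q\<close> is an integer. Periods are indexed from 1 and continued periodically.\<close>

definition preperiod_end :: "int list \<Rightarrow> int" where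
  "preperiod_end as = int (length as) - 1"

definition per :: "int list \<Rightarrow> nat \<Rightarrow> int" where
  "per bs j = bs ! ((j - 1) mod length bs)"

definition even_period :: "int list \<Rightarrow> nat" where
  "even_period bs = (if even (length bs) then length bs else 2 * length bs)"

definition A_const :: "int list \<Rightarrow> real" where
  "A_const as = (\<Sum>k<length as. (-1) powi (int k - 1) * of_int (as ! k))"

definition B_const :: "int list \<Rightarrow> int list \<Rightarrow> real" where
  "B_const as bs = (-1) powi (preperiod_end as) *
     (\<Sum>j=1..even_period bs. (-1) ^ (j - 1) * of_int (per bs j))"

definition C_const :: "int list \<Rightarrow> real" where
  "C_const cs = (\<Sum>j<length cs. 3 - of_int (cs ! j))"

text \<open>The block \<open>[e\<^sub>h, \<dots>, e\<^sub>1, e\<^sub>N, \<dots>, e\<^sub>h\<^sub>+\<^sub>1]\<close> for \<open>1 \<le> h \<le> N\<close>.\<close>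

definition reversed_block :: "(nat \<Rightarrow> int) \<Rightarrow> nat \<Rightarrow> nat \<Rightarrow> int list" where
  "reversed_block e N h = map e (rev [1..<h + 1] @ rev [h + 1..<N + 1])"

definition u_val :: "int list \<Rightarrow> nat \<Rightarrow> real" where
  "u_val bs h = reg_value (periodic_seq [] (reversed_block (per bs) (even_period bs) h))"

definition U_val :: "real \<Rightarrow> int list \<Rightarrow> int list \<Rightarrow> nat \<Rightarrow> real" where
  "U_val z as bs h =
     A_const as
     + (-1) powi (preperiod_end as) * (\<Sum>k=1..h. (-1) ^ (k - 1) * of_int (per bs k))
     + (if odd (preperiod_end as + int h) then z + 1 / u_val bs h - 3
        else z - 1 / u_val bs h)"

definition v_val :: "int list \<Rightarrow> nat \<Rightarrow> real" where
  "v_val ds i = neg_value (periodic_seq [] (reversed_block (per ds) (length ds) i))"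

definition V_val :: "real \<Rightarrow> int list \<Rightarrow> int list \<Rightarrow> nat \<Rightarrow> real" where
  "V_val z cs ds i =
     C_const cs + (\<Sum>j=1..i. 3 - of_int (per ds j)) + z - 1 / v_val ds i - 3"

end

theory Submission
  imports Defs
begin

text \<open>
  The negative regular expansion arises from the regular one by replacing each pair
  \<open>a\<^sub>2\<^sub>n, a\<^sub>2\<^sub>n\<^sub>+\<^sub>1\<close> (\<open>n \<ge> 1\<close>) by \<open>a\<^sub>2\<^sub>n + 2\<close> followed by \<open>a\<^sub>2\<^sub>n\<^sub>+\<^sub>1 - 1\<close> digits \<open>2\<close>. A digit \<open>\<ge> 3\<close>
  therefore starts such a block, and at a block start the alternating digit sum of the regular
  expansion and the sum of the \<open>3 - c\<^sub>j\<close> differ by \<open>1\<close>. Reading the digits backwards from there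
  gives \<open>1/u + 1/v = 1\<close>: by the recursions the defect is at least halved from block to block, and
  it is periodic, hence zero. This yields \<open>V\<^sub>i = U\<^sub>h\<close>; if \<open>i\<close> corresponds to a
  preperiodic regular digit it may first be moved by multiples of \<open>m\<close>, because \<open>B = 0\<close> makes
  \<open>V\<^sub>i\<close> periodic.

  If \<open>q + h\<close> is even and \<open>U\<^sub>h = V\<^sub>i\<close>, then \<open>1/u\<^sub>h - 1/v\<^sub>i\<close> is an integer, so \<open>u\<^sub>h = v\<^sub>i\<close>. But the
  conjugate of a purely periodic \<open>u\<^sub>h\<close> is negative, that of a purely periodic \<open>v\<^sub>i\<close> positive.
\<close>

section \<open>Convergence of the two kinds of continued fractions\<close>

lemma reg_conv_ge_1:
  assumes "\<And>k. s k \<ge> 1"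
  shows "reg_conv n s \<ge> of_int (s 0)" and "reg_conv n s \<ge> 1"
proof -
  have "reg_conv n s \<ge> of_int (s 0) \<and> reg_conv n s \<ge> 1"
    using assms
  proof (induction n arbitrary: s)
    case 0
    then show ?case by simp
  next
    case (Suc n)
    have "reg_conv n (\<lambda>k. s (Suc k)) \<ge> 1"
      using Suc.IH[of "\<lambda>k. s (Suc k)"] Suc.prems by simp
    moreover have "real_of_int (s 0) \<ge> 1" using Suc.prems[of 0] by simp
    ultimately show ?case by (simp add: add_increasing2)
  qed
  then show "reg_conv n s \<ge> of_int (s 0)" and "reg_conv n s \<ge> 1" by auto
qed

lemma reg_conv_le:
  assumes "\<And>k. s k \<ge> 1"
  shows "reg_conv n s \<le> of_int (s 0) + 1"
proof (cases n)
  case (Suc m)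
  have "reg_conv m (\<lambda>k. s (Suc k)) \<ge> 1"
    using assms by (intro reg_conv_ge_1) auto
  then show ?thesis using Suc by simp
qed simp

text \<open>A single step \<open>x -> b + 1/x\<close> shrinks distances only by the factor
  \<open>1/(A B)\<close>, which can be close to 1. Two steps gain the factor
  \<open>1/((b A + 1) (b B + 1))\<close>, which is at most 1/4.\<close>

lemma reg_step_dist:
  fixes A B :: real and b :: int
  assumes "A \<ge> 1" "B \<ge> 1" "b \<ge> 1" "b' \<ge> 1"
  shows "\<bar>(of_int b' + 1 / (of_int b + 1 / A)) - (of_int b' + 1 / (of_int b + 1 / B))\<bar>
           \<le> \<bar>A - B\<bar> / 4"
proof -
  have b: "real_of_int b \<ge> 1" using assms by simp
  have pos: "of_int b * A + 1 \<ge> 2" "of_int b * B + 1 \<ge> 2"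
    using assms b mult_mono[of 1 "real_of_int b" 1 A] mult_mono[of 1 "real_of_int b" 1 B]
    by auto
  have "(of_int b' + 1 / (of_int b + 1 / A)) - (of_int b' + 1 / (of_int b + 1 / B))
        = A / (of_int b * A + 1) - B / (of_int b * B + 1)"
    using assms b by (simp add: field_simps)
  also have "\<dots> = (A - B) / ((of_int b * A + 1) * (of_int b * B + 1))"
    using pos by (simp add: diff_frac_eq) (simp add: algebra_simps)
  finally have eq: "(of_int b' + 1 / (of_int b + 1 / A)) - (of_int b' + 1 / (of_int b + 1 / B))
     = (A - B) / ((of_int b * A + 1) * (of_int b * B + 1))" .
  have "4 \<le> (of_int b * A + 1) * (of_int b * B + 1)"
    using mult_mono[of 2 "of_int b * A + 1" 2 "of_int b * B + 1"] pos by simp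
  then show ?thesis unfolding eq
    using pos divide_left_mono[of 4 "(of_int b * A + 1) * (of_int b * B + 1)" "\<bar>A - B\<bar>"]
    by (simp add: abs_divide abs_of_pos)
qed

lemma reg_conv_dist:
  assumes "\<And>k. s k \<ge> 1"
  shows "\<bar>reg_conv (2 * k + n) s - reg_conv (2 * k + m) s\<bar> \<le> (1 / 4) ^ k"
  using assms
proof (induction k arbitrary: s)
  case 0
  show ?case
    using reg_conv_ge_1(1)[of s n] reg_conv_ge_1(1)[of s m] reg_conv_le[of s n] reg_conv_le[of s m] 0
    by (simp add: abs_le_iff)
next
  case (Suc k)
  let ?t = "\<lambda>k. s (Suc (Suc k))"
  have "\<bar>reg_conv (2 * k + n) ?t - reg_conv (2 * k + m) ?t\<bar> \<le> (1 / 4) ^ k"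
    using Suc by simp
  moreover have "\<bar>reg_conv (2 * Suc k + n) s - reg_conv (2 * Suc k + m) s\<bar>
     \<le> \<bar>reg_conv (2 * k + n) ?t - reg_conv (2 * k + m) ?t\<bar> / 4"
    using reg_step_dist[of "reg_conv (2 * k + n) ?t" "reg_conv (2 * k + m) ?t" "s 1" "s 0"]
      reg_conv_ge_1(2)[of ?t] Suc.prems by simp
  ultimately show ?case by simp
qed

lemma reg_conv_tendsto:
  assumes "\<And>k. s k \<ge> 1"
  shows "(\<lambda>n. reg_conv n s) \<longlonglongrightarrow> reg_value s"
proof -
  have "Cauchy (\<lambda>n. reg_conv n s)"
  proof (rule metric_CauchyI)
    fix e :: real assume "e > 0"
    then obtain k where k: "(1 / 4) ^ k < e"
      using real_arch_pow_inv[of e "1 / 4"] by auto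
    have "dist (reg_conv m s) (reg_conv n s) < e" if "m \<ge> 2 * k" "n \<ge> 2 * k" for m n
    proof -
      have "\<bar>reg_conv (2 * k + (m - 2 * k)) s - reg_conv (2 * k + (n - 2 * k)) s\<bar> \<le> (1 / 4) ^ k"
        by (rule reg_conv_dist) (rule assms)
      then show ?thesis using that k by (simp add: dist_real_def)
    qed
    then show "\<exists>M. \<forall>m\<ge>M. \<forall>n\<ge>M. dist (reg_conv m s) (reg_conv n s) < e" by blast
  qed
  then show ?thesis
    unfolding reg_value_def by (simp add: Cauchy_convergent_iff convergent_LIMSEQ_iff)
qed

lemma reg_value_ge_1:
  assumes "\<And>k. s k \<ge> 1"
  shows "reg_value s \<ge> 1"
proof (rule LIMSEQ_le_const[OF reg_conv_tendsto[OF assms]])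
  show "\<exists>N. \<forall>n\<ge>N. 1 \<le> reg_conv n s"
    using reg_conv_ge_1(2)[of s] assms by meson
qed

lemma reg_value_unfold:
  assumes "\<And>k. s k \<ge> 1"
  shows "reg_value s = of_int (s 0) + 1 / reg_value (\<lambda>k. s (Suc k))"
proof -
  let ?t = "\<lambda>k. s (Suc k)"
  have "(\<lambda>n. of_int (s 0) + 1 / reg_conv n ?t) \<longlonglongrightarrow> of_int (s 0) + 1 / reg_value ?t"
    using reg_conv_tendsto[of ?t] reg_value_ge_1[of ?t] assms by (intro tendsto_intros) auto
  moreover have "(\<lambda>n. of_int (s 0) + 1 / reg_conv n ?t) \<longlonglongrightarrow> reg_value s"
    using LIMSEQ_Suc[OF reg_conv_tendsto[OF assms]] by simp
  ultimately show ?thesis using LIMSEQ_unique by blast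
qed

lemma reg_value_gt_1:
  assumes "\<And>k. s k \<ge> 1"
  shows "reg_value s > 1"
proof -
  have "reg_value (\<lambda>k. s (Suc k)) \<ge> 1" using assms by (intro reg_value_ge_1)
  then have "0 < 1 / reg_value (\<lambda>k. s (Suc k))" by simp
  moreover have "real_of_int (s 0) \<ge> 1" using assms[of 0] by simp
  ultimately show ?thesis using reg_value_unfold[of s, OF assms] by linarith
qed

text \<open>A common denominator \<open>d\<close> of a complete quotient gives a smaller one for the next.\<close>

lemma reg_value_irrational:
  assumes "\<And>k. s k \<ge> 1"
  shows "reg_value s \<notin> \<rat>"
proof
  have no_denom: "reg_value (\<lambda>k. s (k + n)) * of_nat d \<notin> \<int>" if "d > 0" for n d
    using that
  proof (induction d arbitrary: n rule: less_induct)
    case (less d)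
    let ?x = "reg_value (\<lambda>k. s (k + n))" and ?y = "reg_value (\<lambda>k. s (k + Suc n))"
    have y: "?y > 1" using assms by (intro reg_value_gt_1)
    have x: "?x = of_int (s n) + 1 / ?y"
      using reg_value_unfold[of "\<lambda>k. s (k + n)"] assms by simp
    show ?case
    proof
      assume "?x * of_nat d \<in> \<int>"
      then have "?x * of_nat d - of_int (s n) * of_nat d \<in> \<int>" by simp
      moreover have "?x * of_nat d - of_int (s n) * of_nat d = of_nat d / ?y"
        unfolding x by (simp add: algebra_simps)
      ultimately obtain e :: int where e: "of_nat d / ?y = of_int e" by (metis Ints_cases)
      have "0 < of_nat d / ?y" "of_nat d / ?y < of_nat d"
        using y less.prems by (simp_all add: field_simps)
      then have "0 < e" "e < int d" unfolding e by auto
      then have "?y * of_nat (nat e) \<notin> \<int>" by (intro less.IH) auto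
      moreover have "?y * of_nat (nat e) = of_nat d"
        using e y \<open>0 < e\<close> by (simp add: field_simps)
      ultimately show False by simp
    qed
  qed
  assume "reg_value s \<in> \<rat>"
  then obtain p q :: int where "q > 0" "reg_value s = of_int p / of_int q"
    by (metis Rats_cases')
  then have "reg_value s * of_nat (nat q) \<in> \<int>" by simp
  then show False using no_denom[of "nat q" 0] \<open>q > 0\<close> by simp
qed

section \<open>Monotone convergence of negative regular continued fractions\<close>

lemma neg_conv_gt_1:
  assumes "\<And>k. s k \<ge> 2"
  shows "neg_conv n s > 1"
  using assms
proof (induction n arbitrary: s)
  case 0
  have "s 0 \<ge> 2" using 0 .
  then show ?case by simp
next
  case (Suc n)
  have "neg_conv n (\<lambda>k. s (Suc k)) > 1" using Suc by simp
  moreover have "real_of_int (s 0) \<ge> 2" using Suc.prems[of 0] by simp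
  moreover have "1 / neg_conv n (\<lambda>k. s (Suc k)) < 1" using calculation by simp
  ultimately show ?case unfolding neg_conv.simps by linarith
qed

text \<open>The map \<open>x -> s 0 - 1/x\<close> is increasing on positive numbers, so the
  comparison of the first two convergents propagates. With the lower bound 1 this gives
  convergence.\<close>

lemma neg_conv_decreasing:
  assumes "\<And>k. s k \<ge> 2"
  shows "neg_conv (Suc n) s \<le> neg_conv n s"
  using assms
proof (induction n arbitrary: s)
  case 0
  then have "s 1 \<ge> 2" by blast
  then show ?case by simp
next
  case (Suc n)
  let ?t = "\<lambda>k. s (Suc k)"
  have "neg_conv (Suc n) ?t \<le> neg_conv n ?t" by (rule Suc.IH) (rule Suc.prems)
  moreover have "neg_conv (Suc n) ?t > 1"
    using Suc.prems by (intro neg_conv_gt_1)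
  ultimately have "1 / neg_conv n ?t \<le> 1 / neg_conv (Suc n) ?t"
    by (intro divide_left_mono) auto
  then show ?case by (simp only: neg_conv.simps diff_left_mono)
qed

lemma neg_conv_tendsto:
  assumes "\<And>k. s k \<ge> 2"
  shows "(\<lambda>n. neg_conv n s) \<longlonglongrightarrow> neg_value s"
proof -
  have "decseq (\<lambda>n. neg_conv n s)"
    using neg_conv_decreasing[OF assms] by (intro decseq_SucI)
  then obtain L where "(\<lambda>n. neg_conv n s) \<longlonglongrightarrow> L"
    using decseq_convergent[of "\<lambda>n. neg_conv n s" 1] neg_conv_gt_1[of s] assms
    by (meson less_imp_le)
  then show ?thesis unfolding neg_value_def by (simp add: limI)
qed

text \<open>Strictness is lost in the limit: for digits all equal to 2 the convergents
  \<open>(n+2)/(n+1)\<close> tend to 1.\<close>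

lemma neg_value_ge_1:
  assumes "\<And>k. s k \<ge> 2"
  shows "neg_value s \<ge> 1"
proof (rule LIMSEQ_le_const[OF neg_conv_tendsto[OF assms]])
  show "\<exists>N. \<forall>n\<ge>N. 1 \<le> neg_conv n s"
    using neg_conv_gt_1[of s] assms by (meson less_imp_le)
qed

lemma neg_value_unfold:
  assumes "\<And>k. s k \<ge> 2"
  shows "neg_value s = of_int (s 0) - 1 / neg_value (\<lambda>k. s (Suc k))"
proof -
  let ?t = "\<lambda>k. s (Suc k)"
  have "neg_value ?t \<ge> 1" using assms by (intro neg_value_ge_1)
  then have "(\<lambda>n. of_int (s 0) - 1 / neg_conv n ?t) \<longlonglongrightarrow> of_int (s 0) - 1 / neg_value ?t"
    using neg_conv_tendsto[of ?t] assms by (intro tendsto_intros) auto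
  moreover have "(\<lambda>n. of_int (s 0) - 1 / neg_conv n ?t) \<longlonglongrightarrow> neg_value s"
    using LIMSEQ_Suc[OF neg_conv_tendsto[OF assms]] by simp
  ultimately show ?thesis using LIMSEQ_unique by blast
qed

section \<open>Reversed periods\<close>

text \<open>The periodic extension of \<open>ys = [y\<^sub>1, \<dots>, y\<^sub>l]\<close>, read backwards from \<open>y\<^sub>h\<close>.\<close>

definition backward :: "'a list \<Rightarrow> nat \<Rightarrow> nat \<Rightarrow> 'a" where
  "backward ys h n = ys ! nat ((int h - 1 - int n) mod int (length ys))"

lemma backward_Suc_Suc: "backward ys (Suc h) (Suc n) = backward ys h n"
  by (simp add: backward_def diff_diff_eq)

lemma backward_Suc_0: "backward ys (Suc h) 0 = ys ! (h mod length ys)"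
  by (simp add: backward_def nat_mod_distrib)

lemma backward_add_length: "backward ys (h + length ys) = backward ys h"
proof
  fix n
  have "int (h + length ys) - 1 - int n = (int h - 1 - int n) + int (length ys)" by simp
  then show "backward ys (h + length ys) n = backward ys h n"
    unfolding backward_def by (metis mod_add_self2)
qed

lemma backward_in_set: "ys \<noteq> [] \<Longrightarrow> backward ys h n \<in> set ys"
  unfolding backward_def by (intro nth_mem) (simp add: nat_less_iff)

text \<open>\<open>N\<close> may be a proper multiple of the period length, because
  \<open>u_val\<close> uses the even period while \<open>ys\<close> may have odd length.\<close>

lemma periodic_reversed_block:
  assumes "ys \<noteq> []" "length ys dvd N" "1 \<le> h" "h \<le> N"
  shows "periodic_seq [] (reversed_block (per ys) N h) = backward ys h"
proof
  fix n
  have len: "length (reversed_block (per ys) N h) = N"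
    using assms by (simp add: reversed_block_def)
  have per: "per ys j = ys ! nat ((int j - 1) mod int (length ys))" if "j \<ge> 1" for j
    using that by (simp add: per_def nat_mod_distrib nat_diff_distrib)
  \<comment> \<open>Positions \<open>0..h-1\<close> hold the indices \<open>h..1\<close>; from
    position \<open>h\<close> on, the indices run from \<open>N\<close> down to
    \<open>h+1\<close>.\<close>
  have nth: "reversed_block (per ys) N h ! k = per ys (if k < h then h - k else N + h - k)"
    if "k < N" for k
    using that assms
    by (auto simp: reversed_block_def nth_append rev_nth Suc_diff_Suc add.commute simp del: upt_Suc)
  define k where "k = n mod N"
  have k: "k < N" using assms by (simp add: k_def)
  have "periodic_seq [] (reversed_block (per ys) N h) n = reversed_block (per ys) N h ! k"
    by (simp add: periodic_seq_def len k_def)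
  also have "\<dots> = ys ! nat ((int h - 1 - int k) mod int (length ys))"
  proof (cases "k < h")
    case True
    then show ?thesis using nth[OF k] per[of "h - k"] by (simp add: algebra_simps)
  next
    case False
    obtain c where c: "int N = int (length ys) * c"
      using assms(2) by (metis dvd_def of_nat_mult)
    have "(int (N + h - k) - 1) mod int (length ys)
        = (int h - 1 - int k + int (length ys) * c) mod int (length ys)"
      using k c by (simp add: algebra_simps)
    then have "(int (N + h - k) - 1) mod int (length ys)
        = (int h - 1 - int k) mod int (length ys)" by simp
    then show ?thesis using nth[OF k] per[of "N + h - k"] False k assms by simp
  qed
  also have "(int h - 1 - int k) mod int (length ys) = (int h - 1 - int n) mod int (length ys)"
  proof -
    have "int (length ys) dvd int n - int k"
      unfolding k_def using assms(2)
      by (metis dvd_trans int_dvd_int_iff minus_mod_eq_mult_div dvd_triv_left zmod_int)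
    then show ?thesis
      by (smt (verit) mod_eq_dvd_iff)
  qed
  finally show "periodic_seq [] (reversed_block (per ys) N h) n = backward ys h n"
    by (simp add: backward_def)
qed

text \<open>\<open>back_reg bs h\<close> and \<open>back_neg ds i\<close> are \<open>1/u\<^sub>h\<close> and \<open>1/v\<^sub>i\<close>, for all indices.\<close>

definition back_reg :: "int list \<Rightarrow> nat \<Rightarrow> real" where
  "back_reg bs h = 1 / reg_value (backward bs h)"

definition back_neg :: "int list \<Rightarrow> nat \<Rightarrow> real" where
  "back_neg ds i = 1 / neg_value (backward ds i)"

lemma back_reg_add_length: "back_reg bs (h + length bs) = back_reg bs h"
  by (simp add: back_reg_def backward_add_length)

lemma back_neg_add_length: "back_neg ds (h + length ds) = back_neg ds h"
  by (simp add: back_neg_def backward_add_length)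

lemma back_reg_Suc:
  assumes "bs \<noteq> []" "\<forall>b\<in>set bs. b \<ge> 1"
  shows "back_reg bs (Suc h) = 1 / (of_int (bs ! (h mod length bs)) + back_reg bs h)"
  using reg_value_unfold[of "backward bs (Suc h)"] assms backward_in_set[of bs]
  by (simp add: back_reg_def backward_Suc_0 backward_Suc_Suc)

lemma back_neg_Suc:
  assumes "ds \<noteq> []" "\<forall>d\<in>set ds. d \<ge> 2"
  shows "back_neg ds (Suc h) = 1 / (of_int (ds ! (h mod length ds)) - back_neg ds h)"
  using neg_value_unfold[of "backward ds (Suc h)"] assms backward_in_set[of ds]
  by (simp add: back_neg_def backward_Suc_0 backward_Suc_Suc)

lemma back_reg_bounds:
  assumes "bs \<noteq> []" "\<forall>b\<in>set bs. b \<ge> 1"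
  shows "0 < back_reg bs h" "back_reg bs h < 1"
  using reg_value_gt_1[of "backward bs h"] assms backward_in_set[of bs]
  by (simp_all add: back_reg_def)

lemma back_neg_bounds:
  assumes "ds \<noteq> []" "\<forall>d\<in>set ds. d \<ge> 2"
  shows "0 < back_neg ds h" "back_neg ds h \<le> 1"
  using neg_value_ge_1[of "backward ds h"] assms backward_in_set[of ds]
  by (simp_all add: back_neg_def)

text \<open>Iterating \<open>back_reg_Suc\<close> multiplies nonnegative integer matrices. At least
  one step is taken, since the identity would give \<open>q = p' = 0\<close>. Over a full period
  this yields a quadratic equation for \<open>back_reg bs h\<close> whose signs are known.\<close>

lemma back_reg_moebius:
  assumes "bs \<noteq> []" "\<forall>b\<in>set bs. b \<ge> 1"
  shows "\<exists>p p' q q' :: int. p \<ge> 1 \<and> p' \<ge> 1 \<and> q \<ge> 1 \<and> q' \<ge> 0 \<and>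
    back_reg bs (h + Suc n) = (of_int q + of_int q' * back_reg bs h) / (of_int p + of_int p' * back_reg bs h)"
proof (induction n)
  case 0
  have "bs ! (h mod length bs) \<ge> 1" using assms by simp
  then show ?case using back_reg_Suc[OF assms, of h]
    by (intro exI[of _ "bs ! (h mod length bs)"] exI[of _ 1] exI[of _ 1] exI[of _ 0]) simp
next
  case (Suc n)
  then obtain p p' q q' :: int where *: "p \<ge> 1" "p' \<ge> 1" "q \<ge> 1" "q' \<ge> 0"
    "back_reg bs (h + Suc n) = (of_int q + of_int q' * back_reg bs h) / (of_int p + of_int p' * back_reg bs h)"
    by blast
  let ?x = "back_reg bs h" and ?b = "bs ! ((h + Suc n) mod length bs)"
  have b: "?b \<ge> 1" using assms by simp
  have "0 < ?x" using back_reg_bounds[OF assms] by simp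
  then have "of_int p + of_int p' * ?x > 0" using * by (simp add: add_pos_pos)
  then have "of_int ?b + back_reg bs (h + Suc n)
      = (of_int (?b * p + q) + of_int (?b * p' + q') * ?x) / (of_int p + of_int p' * ?x)"
    unfolding *(5) by (simp add: field_simps)
  then have "back_reg bs (h + Suc (Suc n))
      = (of_int p + of_int p' * ?x) / (of_int (?b * p + q) + of_int (?b * p' + q') * ?x)"
    using back_reg_Suc[OF assms, of "h + Suc n"] by simp
  moreover have "?b * p + q \<ge> 1" "?b * p' + q' \<ge> 1"
    using b * mult_mono[of 1 ?b 1 p] mult_mono[of 1 ?b 1 p'] by auto
  ultimately show ?case using *
    by (intro exI[of _ "?b * p + q"] exI[of _ "?b * p' + q'"] exI[of _ p] exI[of _ p']) auto
qed

text \<open>The inequalities \<open>s > t\<close> and \<open>s' > t'\<close> are the invariant that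
  digits \<ge> 2 preserve. The denominator stays positive because each step multiplies it by a
  positive factor \<open>d - y\<close>; this later permits clearing it.\<close>

lemma back_neg_moebius:
  assumes "ds \<noteq> []" "\<forall>d\<in>set ds. d \<ge> 2"
  shows "\<exists>s s' t t' :: int. s > t \<and> s' > t' \<and> t \<ge> 1 \<and> t' \<ge> 0 \<and>
    of_int s - of_int s' * back_neg ds h > 0 \<and>
    back_neg ds (h + Suc n) = (of_int t - of_int t' * back_neg ds h) / (of_int s - of_int s' * back_neg ds h)"
proof (induction n)
  case 0
  have d: "ds ! (h mod length ds) \<ge> 2" using assms by simp
  then have "real_of_int (ds ! (h mod length ds)) \<ge> 2" by linarith
  then have "real_of_int (ds ! (h mod length ds)) - back_neg ds h > 0"
    using back_neg_bounds[OF assms, of h] by linarith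
  then show ?case using back_neg_Suc[OF assms, of h] d
    by (intro exI[of _ "ds ! (h mod length ds)"] exI[of _ 1] exI[of _ 1] exI[of _ 0]) simp
next
  case (Suc n)
  then obtain s s' t t' :: int where *: "s > t" "s' > t'" "t \<ge> 1" "t' \<ge> 0"
    "of_int s - of_int s' * back_neg ds h > 0"
    "back_neg ds (h + Suc n) = (of_int t - of_int t' * back_neg ds h) / (of_int s - of_int s' * back_neg ds h)"
    by blast
  let ?y = "back_neg ds h" and ?d = "ds ! ((h + Suc n) mod length ds)"
  have d: "?d \<ge> 2" using assms by simp
  let ?D = "of_int s - of_int s' * ?y"
  have e: "of_int (?d * s - t) - of_int (?d * s' - t') * ?y = ?D * (of_int ?d - back_neg ds (h + Suc n))"
    using *(5,6) by (simp add: field_simps)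
  have "real_of_int ?d \<ge> 2" using d by linarith
  then have "of_int ?d - back_neg ds (h + Suc n) > 0"
    using back_neg_bounds[OF assms, of "h + Suc n"] by linarith
  then have 1: "of_int (?d * s - t) - of_int (?d * s' - t') * ?y > 0"
    unfolding e using *(5) by (simp del: add_Suc_right)
  have 2: "back_neg ds (h + Suc (Suc n)) = ?D / (of_int (?d * s - t) - of_int (?d * s' - t') * ?y)"
    unfolding e using back_neg_Suc[OF assms, of "h + Suc n"] *(5) by simp
  have 3: "?d * s - t > s" "?d * s' - t' > s'"
    using mult_right_mono[OF d, of s] mult_right_mono[OF d, of s'] *(1-4) by linarith+
  show ?case
    by (rule exI[of _ "?d * s - t"], rule exI[of _ "?d * s' - t'"], rule exI[of _ s], rule exI[of _ s'])
      (use * 1 2 3 in auto)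
qed

text \<open>The conjugates would have opposite signs.\<close>

lemma back_reg_neq_back_neg:
  assumes bs: "bs \<noteq> []" "\<forall>b\<in>set bs. b \<ge> 1" and ds: "ds \<noteq> []" "\<forall>d\<in>set ds. d \<ge> 2"
  shows "back_reg bs h \<noteq> back_neg ds i"
proof
  assume eq: "back_reg bs h = back_neg ds i"
  define x where "x = back_reg bs h"
  have x0: "x > 0" using back_reg_bounds[OF bs] by (simp add: x_def)
  obtain n where n: "length bs = Suc n" using bs(1) by (cases bs) auto
  obtain m where m: "length ds = Suc m" using ds(1) by (cases ds) auto
  obtain p p' q q' :: int where r: "p \<ge> 1" "p' \<ge> 1" "q \<ge> 1" "q' \<ge> 0"
    "x = (of_int q + of_int q' * x) / (of_int p + of_int p' * x)"
    using back_reg_moebius[OF bs, of h n] back_reg_add_length[of bs h] unfolding n x_def by auto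
  obtain s s' t t' :: int where g: "s > t" "s' > t'" "t \<ge> 1" "t' \<ge> 0"
    "of_int s - of_int s' * x > 0" "x = (of_int t - of_int t' * x) / (of_int s - of_int s' * x)"
    using back_neg_moebius[OF ds, of i m] back_neg_add_length[of ds i] unfolding m x_def eq by auto
  have "of_int p + of_int p' * x > 0" using r x0 by (simp add: add_pos_pos)
  \<comment> \<open>The product of the roots is \<open>-q/p' < 0\<close> here, but
    \<open>t/s' > 0\<close> for the second equation.\<close>
  then have 1: "of_int p' * (x * x) = of_int q + of_int (q' - p) * x"
    using r(5) by (simp add: field_simps)
  have 2: "of_int s' * (x * x) = of_int (s + t') * x - of_int t"
    using g(5,6) by (simp add: field_simps)
  \<comment> \<open>Eliminating \<open>x * x\<close> leaves a linear equation whose constant term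
    \<open>p' * t + s' * q\<close> is positive. It is therefore nontrivial and would make
    \<open>x\<close> rational.\<close>
  have "of_int p' * (of_int (s + t') * x - of_int t) = of_int s' * (of_int q + of_int (q' - p) * x)"
    unfolding 1[symmetric] 2[symmetric] by (simp add: algebra_simps)
  then have 3: "of_int (p' * (s + t') - s' * (q' - p)) * x = of_int (p' * t + s' * q)"
    by (simp add: algebra_simps)
  have "p' * t + s' * q > 0" using r g by (intro add_pos_pos mult_pos_pos) auto
  then have "real_of_int (p' * t + s' * q) \<noteq> 0" by linarith
  then have "of_int (p' * (s + t') - s' * (q' - p)) \<noteq> (0::real)" using 3 by auto
  then have "x = of_int (p' * t + s' * q) / of_int (p' * (s + t') - s' * (q' - p))"
    using 3 by (metis nonzero_mult_div_cancel_left)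
  then have "x \<in> \<rat>" by simp
  then have "1 / x \<in> \<rat>" by simp
  moreover have "1 / x \<notin> \<rat>"
    using reg_value_irrational[of "backward bs h"] bs backward_in_set[of bs]
    by (simp add: x_def back_reg_def)
  ultimately show False by simp
qed

section \<open>From the regular to the negative regular expansion\<close>

lemma reg_rem_irrational:
  assumes "z \<notin> \<rat>"
  shows "reg_rem z k \<notin> \<rat>"
proof (induction k)
  case (Suc k)
  show ?case
  proof
    assume "reg_rem z (Suc k) \<in> \<rat>"
    then have "1 / reg_rem z (Suc k) + of_int \<lfloor>reg_rem z k\<rfloor> \<in> \<rat>"
      by (intro Rats_add Rats_divide) simp_all
    then show False using Suc by simp
  qed
qed (use assms in simp)

lemma irrational_floor_less:
  fixes x :: real
  assumes "x \<notin> \<rat>"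
  shows "of_int \<lfloor>x\<rfloor> < x"
  using assms by (metis Rats_of_int of_int_floor_le order_le_less)

lemma reg_rem_gt_1:
  assumes "z \<notin> \<rat>"
  shows "reg_rem z (Suc k) > 1"
proof -
  have "of_int \<lfloor>reg_rem z k\<rfloor> < reg_rem z k"
    using irrational_floor_less[OF reg_rem_irrational[OF assms]] .
  moreover have "reg_rem z k - of_int \<lfloor>reg_rem z k\<rfloor> < 1" by linarith
  ultimately show ?thesis by (simp add: less_divide_eq_1_pos)
qed

lemma reg_coeff_pos:
  assumes "z \<notin> \<rat>"
  shows "reg_coeff z (Suc k) \<ge> 1"
  using reg_rem_gt_1[OF assms, of k] by (simp add: reg_coeff_def le_floor_iff del: reg_rem.simps)

lemma reg_rem_unfold:
  "reg_rem z k = of_int (reg_coeff z k) + 1 / reg_rem z (Suc k)"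
  by (simp add: reg_coeff_def)

text \<open>Position in the negative expansion of the block that comes from the regular digits with
  indices \<open>2n\<close> and \<open>2n+1\<close>; its length is the odd-indexed digit. Only such
  digits enter, and they are positive, so \<open>nat\<close> loses nothing.\<close>

primrec block_start :: "real \<Rightarrow> nat \<Rightarrow> nat" where
  "block_start z 0 = 0"
| "block_start z (Suc n) = block_start z n + nat (reg_coeff z (2 * n + 1))"

lemma block_start_less:
  assumes "z \<notin> \<rat>"
  shows "block_start z n < block_start z (Suc n)"
  using reg_coeff_pos[OF assms, of "2 * n"] by simp

lemma block_start_strict_mono:
  assumes "z \<notin> \<rat>"
  shows "strict_mono (block_start z)"
  using block_start_less[OF assms] by (simp add: strict_mono_Suc_iff)

lemma ceiling_eq_Suc_reg_coeff:
  assumes "z \<notin> \<rat>"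
  shows "\<lceil>reg_rem z k\<rceil> = reg_coeff z k + 1"
  using irrational_floor_less[OF reg_rem_irrational[OF assms, of k]]
  unfolding reg_coeff_def by linarith

text \<open>The block starting at \<open>block_start z n\<close> consists of the digit \<open>a\<^sub>2\<^sub>n + 2\<close>
  (\<open>a\<^sub>0 + 1\<close> if \<open>n = 0\<close>), followed by \<open>a\<^sub>2\<^sub>n\<^sub>+\<^sub>1 - 1\<close> digits \<open>2\<close>.\<close>

lemma neg_rem_in_block:
  assumes z: "z \<notin> \<rat>"
    and start: "neg_rem z j = reg_rem z (2 * n) + of_int e"
    and i: "int i < reg_coeff z (2 * n + 1)"
  shows "neg_rem z (j + Suc i) = 1 + 1 / (reg_rem z (2 * n + 1) - of_nat (Suc i))"
  using i
proof (induction i)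
  case 0
  let ?w = "reg_rem z (2 * n + 1)"
  have w: "?w > 1" using reg_rem_gt_1[OF z, of "2 * n"] by simp
  \<comment> \<open>The integer shift \<open>e\<close> cancels between the remainder and its
    ceiling, so it affects only the first digit of the block.\<close>
  have "\<lceil>neg_rem z j\<rceil> = reg_coeff z (2 * n) + 1 + e"
    unfolding start using ceiling_eq_Suc_reg_coeff[OF z, of "2 * n"] by simp
  then have "of_int \<lceil>neg_rem z j\<rceil> - neg_rem z j = 1 - 1 / ?w"
    unfolding start using reg_rem_unfold[of z "2 * n"] by (simp del: reg_rem.simps)
  then have "neg_rem z (j + Suc 0) = 1 / (1 - 1 / ?w)" by simp
  also have "\<dots> = 1 + 1 / (?w - 1)" using w by (simp add: field_simps del: reg_rem.simps)
  finally show ?case by (simp del: reg_rem.simps neg_rem.simps)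
next
  case (Suc i)
  let ?w = "reg_rem z (2 * n + 1)"
  have "real_of_int (reg_coeff z (2 * n + 1)) < ?w"
    unfolding reg_coeff_def using irrational_floor_less[OF reg_rem_irrational[OF z]] .
  moreover have "real (Suc i) + 1 \<le> of_int (reg_coeff z (2 * n + 1))"
    using Suc.prems by linarith
  ultimately have w: "?w - real (Suc i) > 1" by linarith
  have IH: "neg_rem z (j + Suc i) = 1 + 1 / (?w - real (Suc i))" by (rule Suc.IH) (use Suc.prems in simp)
  have "0 < 1 / (?w - real (Suc i))" "1 / (?w - real (Suc i)) < 1" using w by simp_all
  then have "\<lceil>neg_rem z (j + Suc i)\<rceil> = 2" unfolding IH by linarith
  then have "neg_rem z (j + Suc (Suc i)) = 1 / (2 - neg_rem z (j + Suc i))" by simp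
  also have "\<dots> = 1 / (1 - 1 / (?w - real (Suc i)))" unfolding IH by simp
  also have "\<dots> = 1 + 1 / (?w - real (Suc i) - 1)" using w by (simp add: field_simps del: reg_rem.simps)
  also have "?w - real (Suc i) - 1 = ?w - real (Suc (Suc i))" by (simp del: reg_rem.simps)
  finally show ?case .
qed

text \<open>At the end of a block the remainder is \<open>1 + 1/(w - a)\<close> with
  \<open>a\<close> the floor of \<open>w\<close>, that is, 1 plus the next regular remainder. This
  extra 1 is why later blocks begin with the regular digit plus 2 and the first one with the regular
  digit plus 1.\<close>

lemma neg_rem_block_start:
  assumes z: "z \<notin> \<rat>"
  shows "neg_rem z (block_start z n) = reg_rem z (2 * n) + of_int (if n = 0 then 0 else 1)"
proof (induction n)
  case (Suc n)
  define a where "a = reg_coeff z (2 * n + 1)"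
  have a: "a \<ge> 1" unfolding a_def using reg_coeff_pos[OF z, of "2 * n"] by simp
  define i where "i = nat (a - 1)"
  have i: "a = int (Suc i)" using a by (simp add: i_def)
  have "neg_rem z (block_start z n + Suc i) = 1 + 1 / (reg_rem z (2 * n + 1) - of_nat (Suc i))"
    using i by (intro neg_rem_in_block[OF z Suc]) (simp add: a_def)
  also have "of_nat (Suc i) = real_of_int a" using i by simp
  also have "1 / (reg_rem z (2 * n + 1) - real_of_int a) = reg_rem z (2 * Suc n)"
    by (simp add: a_def reg_coeff_def)
  finally have "neg_rem z (block_start z n + Suc i) = reg_rem z (2 * Suc n) + 1"
    by (simp only: add.commute)
  moreover have "block_start z (Suc n) = block_start z n + Suc i" using i by (simp add: a_def)
  ultimately show ?case by (simp del: reg_rem.simps neg_rem.simps)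
qed simp

lemma neg_coeff_block_start:
  assumes z: "z \<notin> \<rat>"
  shows "neg_coeff z (block_start z n) = reg_coeff z (2 * n) + (if n = 0 then 1 else 2)"
  using ceiling_eq_Suc_reg_coeff[OF z, of "2 * n"]
  unfolding neg_coeff_def neg_rem_block_start[OF z] by simp

lemma neg_coeff_in_block:
  assumes z: "z \<notin> \<rat>" and i: "int (Suc i) < reg_coeff z (2 * n + 1)"
  shows "neg_coeff z (block_start z n + Suc i) = 2"
proof -
  let ?w = "reg_rem z (2 * n + 1)"
  have "real_of_int (reg_coeff z (2 * n + 1)) < ?w"
    unfolding reg_coeff_def using irrational_floor_less[OF reg_rem_irrational[OF z]] .
  moreover have "real (Suc i) + 1 \<le> of_int (reg_coeff z (2 * n + 1))"
    using i by linarith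
  ultimately have "?w - real (Suc i) > 1" by linarith
  then have "0 < 1 / (?w - real (Suc i))" "1 / (?w - real (Suc i)) < 1" by simp_all
  moreover have "neg_rem z (block_start z n + Suc i) = 1 + 1 / (?w - real (Suc i))"
    using i by (intro neg_rem_in_block[OF z neg_rem_block_start[OF z]]) simp
  ultimately show ?thesis unfolding neg_coeff_def by linarith
qed

lemma block_cases:
  assumes z: "z \<notin> \<rat>"
  obtains n i where "j = block_start z n + i" "int i < reg_coeff z (2 * n + 1)"
proof -
  have "\<exists>n. block_start z n \<le> j \<and> j < block_start z (Suc n)"
  proof (induction j)
    case 0
    show ?case using block_start_less[OF z, of 0] by (intro exI[of _ 0]) simp
  next
    case (Suc j)
    then obtain n where "block_start z n \<le> j" "j < block_start z (Suc n)" by blast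
    then show ?case using block_start_less[OF z, of "Suc n"]
      by (cases "Suc j < block_start z (Suc n)") (auto simp del: block_start.simps intro: exI[of _ n] exI[of _ "Suc n"])
  qed
  then obtain n where "block_start z n \<le> j" "j < block_start z (Suc n)" by blast
  then show thesis by (intro that[of n "j - block_start z n"]) auto
qed

text \<open>The hypothesis on \<open>per ds (i + 1)\<close> enters the main proof through this
  fact.\<close>

lemma neg_coeff_ge_3_imp_block_start:
  assumes z: "z \<notin> \<rat>" and c: "neg_coeff z j \<ge> 3"
  obtains n where "j = block_start z n"
proof -
  obtain n i where "j = block_start z n + i" "int i < reg_coeff z (2 * n + 1)"
    using block_cases[OF z] .
  then show thesis using neg_coeff_in_block[OF z, of _ n] c that by (cases i) auto
qed

lemma neg_coeff_ge_2:
  assumes z: "z \<notin> \<rat>" and j: "j > 0"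
  shows "neg_coeff z j \<ge> 2"
proof -
  obtain n i where n: "j = block_start z n + i" "int i < reg_coeff z (2 * n + 1)"
    using block_cases[OF z] .
  show ?thesis
  proof (cases i)
    case 0
    then obtain k where "n = Suc k" using j n by (cases n) auto
    then show ?thesis
      using n 0 neg_coeff_block_start[OF z, of n] reg_coeff_pos[OF z, of "2 * k + 1"] by simp
  qed (use n neg_coeff_in_block[OF z, of _ n] in simp)
qed

section \<open>Comparison of the digit sums of the two expansions\<close>

definition alt_sum :: "real \<Rightarrow> nat \<Rightarrow> int" where
  "alt_sum z K = (\<Sum>k<K. - ((-1) ^ k) * reg_coeff z k)"

definition neg_sum :: "real \<Rightarrow> nat \<Rightarrow> int" where
  "neg_sum z N = (\<Sum>j<N. 3 - neg_coeff z j)"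

lemma neg_sum_in_block:
  assumes z: "z \<notin> \<rat>" and i: "int i < reg_coeff z (2 * n + 1)"
  shows "neg_sum z (block_start z n + Suc i)
    = neg_sum z (block_start z n) + (3 - neg_coeff z (block_start z n)) + int i"
  using i
proof (induction i)
  case (Suc i)
  then show ?case using neg_coeff_in_block[OF z, of i n] by (simp add: neg_sum_def)
qed (simp add: neg_sum_def)

text \<open>A block with regular digits \<open>a, a'\<close> contributes
  \<open>3 - (a + 2) + (a' - 1) = -a + a'\<close>, exactly its share of the alternating sum. The
  first block has \<open>a + 1\<close> in place of \<open>a + 2\<close>, which gives the permanent
  offset 1.\<close>

lemma neg_sum_block_start:
  assumes z: "z \<notin> \<rat>"
  shows "neg_sum z (block_start z n) = alt_sum z (2 * n) + (if n = 0 then 0 else 1)"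
proof (induction n)
  case (Suc n)
  have "reg_coeff z (2 * n + 1) \<ge> 1" using reg_coeff_pos[OF z, of "2 * n"] by simp
  moreover define i where "i = nat (reg_coeff z (2 * n + 1) - 1)"
  ultimately have i: "reg_coeff z (2 * n + 1) = int (Suc i)" by simp
  have "block_start z (Suc n) = block_start z n + Suc i" using i by simp
  then have "neg_sum z (block_start z (Suc n)) =
      neg_sum z (block_start z n) + (3 - neg_coeff z (block_start z n)) + int i"
    using neg_sum_in_block[OF z, of i n] i by simp
  also have "\<dots> = alt_sum z (2 * n) + 2 - reg_coeff z (2 * n) + int i"
    using Suc neg_coeff_block_start[OF z, of n] by simp
  also have "\<dots> = alt_sum z (2 * Suc n) + 1"
    using i by (simp add: alt_sum_def)
  finally show ?case by simp
qed (simp add: neg_sum_def alt_sum_def)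


text \<open>With zero defect, \<open>y\<close> would run through the values
  \<open>1 - 1/(i + 1 + X)\<close> inside the block. The first digit turns the defect
  \<open>D\<close> into the deviation \<open>D * y / w\<close> with \<open>y \<le> 1\<close> and
  \<open>w \<ge> 2\<close>; the digits 2 never enlarge it.\<close>

lemma block_step_dist:
  assumes z: "z \<notin> \<rat>" and n: "n > 0"
    and x: "x (2 * n) > 0"
      "x (2 * n + 1) = 1 / (of_int (reg_coeff z (2 * n)) + x (2 * n))"
      "x (2 * n + 2) = 1 / (of_int (reg_coeff z (2 * n + 1)) + x (2 * n + 1))"
    and y: "\<And>N. N \<ge> block_start z n \<Longrightarrow> y (Suc N) = 1 / (of_int (neg_coeff z N) - y N)"
      "\<And>N. 0 < y N" "\<And>N. y N \<le> (1::real)"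
  shows "\<bar>x (2 * Suc n) + y (block_start z (Suc n)) - 1\<bar> \<le> \<bar>x (2 * n) + y (block_start z n) - 1\<bar> / 2"
proof -
  let ?J = "block_start z n"
  define D where "D = x (2 * n) + y ?J - 1"
  define a where "a = real_of_int (reg_coeff z (2 * n))"
  define X where "X = x (2 * n + 1)"
  obtain n' where n': "n = Suc n'" using n by (cases n) auto
  have "reg_coeff z (2 * n) \<ge> 1" unfolding n' using reg_coeff_pos[OF z, of "2 * n' + 1"] by simp
  then have a: "a \<ge> 1" by (simp add: a_def)
  have X: "X = 1 / (a + x (2 * n))" using x(2) by (simp add: X_def a_def)
  then have X0: "X > 0" using a x(1) by simp
  have dist: "\<bar>y (?J + Suc i) - (1 - 1 / (of_nat (Suc i) + X))\<bar> \<le> \<bar>D\<bar> / 2"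
    if "int i < reg_coeff z (2 * n + 1)" for i
    using that
  proof (induction i)
    case 0
    define w where "w = a + 1 + x (2 * n)"
    have w: "w \<ge> 2" using a x(1) by (simp add: w_def)
    have "1 - 1 / (1 + X) = 1 / w"
      unfolding X w_def using a x(1) by (simp add: field_simps)
    moreover have "y (Suc ?J) = 1 / (w - D)"
      using y(1)[of ?J] neg_coeff_block_start[OF z, of n] n
      by (simp add: w_def D_def a_def algebra_simps)
    moreover have "w - D > 0" using y(3)[of ?J] a by (simp add: w_def D_def)
    then have "1 / (w - D) - 1 / w = D * (1 / (w - D)) * (1 / w)"
      using w by (simp add: field_simps)
    ultimately have "y (Suc ?J) - (1 - 1 / (1 + X)) = D * y (Suc ?J) * (1 / w)" by simp
    moreover have "\<bar>y (Suc ?J) * (1 / w)\<bar> \<le> 1 * (1 / 2)"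
      unfolding abs_mult using y(2,3)[of "Suc ?J"] w by (intro mult_mono) (auto simp: field_simps)
    then have "\<bar>D\<bar> * \<bar>y (Suc ?J) * (1 / w)\<bar> \<le> \<bar>D\<bar> * (1 / 2)"
      by (intro mult_left_mono) auto
    ultimately show ?case by (simp add: abs_mult mult.assoc)
  next
    case (Suc i)
    define p where "p = y (?J + Suc i)"
    define q where "q = 1 - 1 / (of_nat (Suc i) + X)"
    have IH: "\<bar>p - q\<bar> \<le> \<bar>D\<bar> / 2" unfolding p_def q_def by (rule Suc.IH) (use Suc.prems in simp)
    have p: "p \<le> 1" using y(3) by (simp add: p_def)
    have q: "q \<le> 1" using X0 by (simp add: q_def)
    have "y (?J + Suc (Suc i)) = 1 / (2 - p)"
      using y(1)[of "?J + Suc i"] neg_coeff_in_block[OF z, of i n] Suc.prems by (simp add: p_def)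
    moreover have "1 - 1 / (of_nat (Suc (Suc i)) + X) = 1 / (2 - q)"
      using X0 by (simp add: q_def field_simps)
    moreover have "1 / (2 - p) - 1 / (2 - q) = (p - q) / ((2 - p) * (2 - q))"
      using p q by (simp add: field_simps)
    moreover have "1 \<le> (2 - p) * (2 - q)"
      using mult_mono[of 1 "2 - p" 1 "2 - q"] p q by simp
    then have "\<bar>p - q\<bar> / ((2 - p) * (2 - q)) \<le> \<bar>p - q\<bar>"
      using divide_left_mono[of 1 "(2 - p) * (2 - q)" "\<bar>p - q\<bar>"] by simp
    moreover have "\<bar>(p - q) / ((2 - p) * (2 - q))\<bar> = \<bar>p - q\<bar> / ((2 - p) * (2 - q))"
      using p q by (simp add: abs_mult)
    ultimately show ?case using IH by (simp only:)
  qed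
  have a1: "reg_coeff z (2 * n + 1) \<ge> 1" using reg_coeff_pos[OF z, of "2 * n"] by simp
  define i where "i = nat (reg_coeff z (2 * n + 1) - 1)"
  have i: "reg_coeff z (2 * n + 1) = int (Suc i)" using a1 by (simp add: i_def)
  \<comment> \<open>At the end of the block the counter equals the odd-indexed digit, so the
    comparison value becomes \<open>1 - x (2 * Suc n)\<close>.\<close>
  have "1 / (of_nat (Suc i) + X) = x (2 * Suc n)"
    using x(3) i by (simp add: X_def)
  moreover have "?J + Suc i = block_start z (Suc n)" using i by simp
  moreover have "\<bar>y (?J + Suc i) - (1 - 1 / (of_nat (Suc i) + X))\<bar> \<le> \<bar>D\<bar> / 2"
    by (rule dist) (use i in linarith)
  ultimately have "\<bar>y (block_start z (Suc n)) - (1 - x (2 * Suc n))\<bar> \<le> \<bar>D\<bar> / 2"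
    by (simp only:)
  moreover have "y (block_start z (Suc n)) - (1 - x (2 * Suc n))
      = x (2 * Suc n) + y (block_start z (Suc n)) - 1" by linarith
  ultimately show ?thesis by (simp only: D_def)
qed

section \<open>Periodicity\<close>

lemma periodic_seq_add: "periodic_seq xs ys (length xs + k) = ys ! (k mod length ys)"
  by (simp add: periodic_seq_def)

lemma periodic_seq_periodic:
  assumes "length ys dvd p" "N \<ge> length xs"
  shows "periodic_seq xs ys (N + p) = periodic_seq xs ys N"
proof -
  obtain k where "N = length xs + k" using assms(2) le_Suc_ex by blast
  moreover obtain c where "p = length ys * c" using assms(1) by blast
  ultimately show ?thesis using periodic_seq_add[of xs ys k] periodic_seq_add[of xs ys "k + p"]
    by (simp add: add.assoc)
qed

text \<open>Sliding a window of length \<open>p\<close> does not change its sum, so the fixed window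
  at \<open>k\<close> serves every \<open>N\<close>.\<close>

lemma sum_periodic:
  fixes g :: "nat \<Rightarrow> 'a :: comm_semiring_1"
  assumes per: "\<And>N. N \<ge> k \<Longrightarrow> g (N + p) = g N" and N: "N \<ge> k"
  shows "(\<Sum>j<N + t * p. g j) = (\<Sum>j<N. g j) + of_nat t * (\<Sum>j=k..<k + p. g j)"
proof -
  have step: "(\<Sum>j<N + p. g j) = (\<Sum>j<N. g j) + (\<Sum>j=k..<k + p. g j)" if "N \<ge> k" for N
    using that
  proof (induction N rule: dec_induct)
    case base
    show ?case by (simp add: lessThan_atLeast0 sum.atLeastLessThan_concat)
  next
    case (step N)
    then show ?case by (simp add: per algebra_simps)
  qed
  show ?thesis
  proof (induction t)
    case (Suc t)
    then show ?case using step[of "N + t * p"] N by (simp add: algebra_simps)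
  qed simp
qed

lemma eventually_periodic_mult:
  fixes N :: nat
  assumes "\<And>N. N \<ge> k \<Longrightarrow> f (N + p) = f N" "N \<ge> k"
  shows "f (N + t * p) = f N"
proof (induction t)
  case (Suc t)
  then show ?case using assms(1)[of "N + t * p"] assms(2) by (simp add: algebra_simps)
qed simp

lemma block_start_eq_sum: "block_start z n = (\<Sum>k<n. nat (reg_coeff z (2 * k + 1)))"
  by (induction n) auto

text \<open>Since a block uses two regular digits, \<open>2 * l\<close> regular digits make
  \<open>l\<close> blocks; \<open>S\<close> counts the negative digits they produce.\<close>

lemma block_start_periodic:
  assumes z: "z \<notin> \<rat>" and per: "\<And>K. K \<ge> k \<Longrightarrow> reg_coeff z (K + 2 * l) = reg_coeff z K"
    and l: "l > 0"
  obtains S where "S > 0" "\<And>n t. 2 * n \<ge> k \<Longrightarrow> block_start z (n + t * l) = block_start z n + t * S"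
proof -
  define S where "S = (\<Sum>j=k..<k + l. nat (reg_coeff z (2 * j + 1)))"
  have "block_start z (n + t * l) = block_start z n + t * S" if "2 * n \<ge> k" for n t
  proof -
    obtain S' where S': "\<And>N t. 2 * N \<ge> k \<Longrightarrow> block_start z (N + t * l) = block_start z N + t * S'"
    proof -
      have "nat (reg_coeff z (2 * (N + l) + 1)) = nat (reg_coeff z (2 * N + 1))"
        if "N \<ge> (k + 1) div 2" for N
        using per[of "2 * N + 1"] that by (simp add: algebra_simps)
      from sum_periodic[of "(k + 1) div 2" "\<lambda>N. nat (reg_coeff z (2 * N + 1))", OF this]
      show thesis by (intro that) (auto simp: block_start_eq_sum)
    qed
    \<comment> \<open>The window of \<open>S\<close> starts at \<open>k\<close>, that of
      \<open>S'\<close> at \<open>(k + 1) div 2\<close>; evaluation at block \<open>k\<close>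
      identifies them.\<close>
    have "S = S'"
      using S'[of k 1] sum.atLeastLessThan_concat[of 0 k "k + l" "\<lambda>j. nat (reg_coeff z (2 * j + 1))"]
      by (simp add: S_def block_start_eq_sum lessThan_atLeast0)
    then show ?thesis using S' that by simp
  qed
  moreover from this[of k 1] have "S > 0"
    using strict_monoD[OF block_start_strict_mono[OF z], of k "k + l"] l by simp
  ultimately show thesis using that by blast
qed

text \<open>The defect \<open>x (2n) + y (block_start z n) - 1\<close> is at least halved by each block, but
  periodic in \<open>n\<close>.\<close>

lemma reversed_values_sum_1:
  assumes z: "z \<notin> \<rat>"
    and a: "\<And>K. K \<ge> k \<Longrightarrow> reg_coeff z (K + 2 * l) = reg_coeff z K"
    and l: "l > 0" and m: "m > 0"
    and x: "\<And>K. K \<ge> k \<Longrightarrow> x (Suc K) = 1 / (of_int (reg_coeff z K) + x K)"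
      "\<And>K. 0 < x K" "\<And>K. K \<ge> k \<Longrightarrow> x (K + 2 * l) = x K"
    and y: "\<And>N. N \<ge> r \<Longrightarrow> y (Suc N) = 1 / (of_int (neg_coeff z N) - y N)"
      "\<And>N. 0 < y N" "\<And>N. y N \<le> (1::real)" "\<And>N. N \<ge> r \<Longrightarrow> y (N + m) = y N"
    and n: "n > 0" "2 * n \<ge> k" "block_start z n \<ge> r"
  shows "x (2 * n) + y (block_start z n) = 1"
proof -
  define D where "D n = x (2 * n) + y (block_start z n) - 1" for n
  obtain S where S: "\<And>n t. 2 * n \<ge> k \<Longrightarrow> block_start z (n + t * l) = block_start z n + t * S"
    using block_start_periodic[OF z a l] by metis
  have mono: "block_start z (n + t) \<ge> block_start z n" for t
    using strict_mono_mono[OF block_start_strict_mono[OF z]] by (simp add: mono_def)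
  have decay: "\<bar>D (n + t)\<bar> \<le> \<bar>D n\<bar> / 2 ^ t" for t
  proof (induction t)
    case (Suc t)
    have "\<bar>D (Suc (n + t))\<bar> \<le> \<bar>D (n + t)\<bar> / 2"
      unfolding D_def
      by (rule block_step_dist[OF z])
        (use x(1)[of "2 * (n + t)"] x(1)[of "2 * (n + t) + 1"] x(2) y n mono[of t] in auto)
    then show ?case using Suc by simp
  qed simp
  \<comment> \<open>Passing \<open>m * l\<close> blocks moves the regular index by \<open>m\<close>
    periods \<open>2 * l\<close> and the negative index by \<open>S\<close> periods
    \<open>m\<close>, so both values return.\<close>
  have "x (2 * (n + m * l)) = x (2 * n)"
    using eventually_periodic_mult[of k x "2 * l" "2 * n" m] x(3) n(2) by (simp add: algebra_simps)
  moreover have "y (block_start z (n + m * l)) = y (block_start z n)"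
    using eventually_periodic_mult[of r y m "block_start z n" S] y(4) n(3) S[OF n(2), of m]
    by (simp add: mult.commute)
  ultimately have "\<bar>D n\<bar> \<le> \<bar>D n\<bar> / 2 ^ (m * l)"
    using decay[of "m * l"] by (simp add: D_def)
  moreover have "(2::real) ^ (m * l) > 1" using m l by (intro one_less_power) auto
  ultimately have "D n = 0" by (simp add: field_simps) (smt (verit) mult_less_cancel_left1)
  then show ?thesis by (simp add: D_def)
qed

text \<open>Let \<open>D\<close> be the growth of \<open>neg_sum\<close> over \<open>m\<close>
  digits. Over \<open>m * l\<close> blocks \<open>neg_sum\<close> grows by \<open>S * D\<close>,
  while \<open>alt_sum\<close>, equal to it up to a constant at block starts, does not change. As
  \<open>S > 0\<close>, \<open>D\<close> vanishes.\<close>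

lemma neg_sum_periodic:
  assumes z: "z \<notin> \<rat>"
    and a: "\<And>K. K \<ge> k \<Longrightarrow> reg_coeff z (K + 2 * l) = reg_coeff z K" and l: "l > 0"
    and alt: "\<And>K. K \<ge> k \<Longrightarrow> alt_sum z (K + 2 * l) = alt_sum z K"
    and c: "\<And>N. N \<ge> r \<Longrightarrow> neg_coeff z (N + m) = neg_coeff z N" and m: "m > 0"
    and N: "N \<ge> r"
  shows "neg_sum z (N + t * m) = neg_sum z N"
proof -
  obtain S where S: "S > 0"
    "\<And>n t. 2 * n \<ge> k \<Longrightarrow> block_start z (n + t * l) = block_start z n + t * S"
    using block_start_periodic[OF z a l] by metis
  define D where "D = (\<Sum>j=r..<r + m. 3 - neg_coeff z j)"
  have neg: "neg_sum z (N + t * m) = neg_sum z N + int t * D" if "N \<ge> r" for N t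
    unfolding neg_sum_def D_def using sum_periodic[of r "\<lambda>j. 3 - neg_coeff z j"] c that by simp
  define n where "n = Suc (k + r)"
  have "block_start z n \<ge> n"
    using strict_mono_imp_increasing[OF block_start_strict_mono[OF z]] .
  then have r: "block_start z n \<ge> r" by (simp add: n_def)
  have "neg_sum z (block_start z n) + int S * D = neg_sum z (block_start z (n + m * l))"
    using neg[OF r, of S] S(2)[of n m] by (simp add: n_def mult.commute)
  also have "\<dots> = alt_sum z (2 * n + m * (2 * l)) + 1"
    using neg_sum_block_start[OF z, of "n + m * l"] by (simp add: n_def algebra_simps)
  also have "alt_sum z (2 * n + m * (2 * l)) = alt_sum z (2 * n)"
    using alt by (rule eventually_periodic_mult) (auto simp: n_def)
  also have "\<dots> + 1 = neg_sum z (block_start z n)"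
    using neg_sum_block_start[OF z, of n] by (simp add: n_def)
  finally have "D = 0" using S(1) by simp
  then show ?thesis using neg[OF N] by simp
qed

section \<open>Expressing \<open>U\<^sub>h\<close> and \<open>V\<^sub>i\<close> by the digits of \<open>z\<close>\<close>

lemma minus_one_powi_pred: "(-1 :: real) powi (int k - 1) = - ((-1) ^ k)"
  by (simp add: power_int_diff)

lemma per_Suc: "per ys (Suc k) = ys ! (k mod length ys)"
  by (simp add: per_def)

lemma alt_sum_eq:
  assumes "reg_coeff z = periodic_seq as bs"
  shows "of_int (alt_sum z (length as + h)) = A_const as
    + (-1) powi (preperiod_end as) * (\<Sum>k=1..h. (-1) ^ (k - 1) * of_int (per bs k))"
proof (induction h)
  case 0
  show ?case unfolding alt_sum_def A_const_def
    using assms by (simp add: minus_one_powi_pred periodic_seq_def)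
next
  case (Suc h)
  have "real_of_int (alt_sum z (length as + Suc h))
      = of_int (alt_sum z (length as + h)) - (-1) ^ (length as + h) * of_int (per bs (Suc h))"
    by (simp add: alt_sum_def assms periodic_seq_add per_Suc)
  then show ?case using Suc
    by (simp add: preperiod_end_def minus_one_powi_pred power_add algebra_simps)
qed

text \<open>The even period makes the signs repeat along with the digits, so each such period adds
  the same amount, namely \<open>B_const as bs\<close>.\<close>

lemma alt_sum_periodic:
  assumes s: "reg_coeff z = periodic_seq as bs" and B: "B_const as bs = 0" and K: "K \<ge> length as"
  shows "alt_sum z (K + t * even_period bs) = alt_sum z K"
proof -
  let ?g = "\<lambda>k. - ((-1) ^ k) * reg_coeff z k" and ?L = "even_period bs"
  have L: "even ?L" "length bs dvd ?L" by (auto simp: even_period_def)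
  have per: "?g (N + ?L) = ?g N" if "N \<ge> length as" for N
    using L periodic_seq_periodic[of bs ?L as N] that s by (simp add: power_add)
  have sum: "alt_sum z (N + t * ?L) = alt_sum z N + int t * (\<Sum>k=length as..<length as + ?L. ?g k)"
    if "N \<ge> length as" for N t
    unfolding alt_sum_def using sum_periodic[of "length as" ?g ?L, OF per that] by simp
  have "real_of_int (alt_sum z (length as + ?L)) = of_int (alt_sum z (length as))"
    using alt_sum_eq[OF s, of ?L] alt_sum_eq[OF s, of 0] B by (simp add: B_const_def)
  then have "(\<Sum>k=length as..<length as + ?L. ?g k) = 0"
    using sum[of "length as" 1] by simp
  then show ?thesis using sum[OF K] by simp
qed

text \<open>The parity flips because \<open>q = length as - 1\<close>: \<open>q + h\<close> is odd
  exactly when \<open>length as + h\<close> is even.\<close>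

lemma U_val_eq:
  assumes s: "reg_coeff z = periodic_seq as bs" and bs: "bs \<noteq> []" and h: "h \<in> {1..even_period bs}"
  shows "U_val z as bs h = of_int (alt_sum z (length as + h)) +
    (if even (length as + h) then z + back_reg bs h - 3 else z - back_reg bs h)"
proof -
  have "1 / u_val bs h = back_reg bs h"
    unfolding u_val_def back_reg_def using h bs
    by (subst periodic_reversed_block) (auto simp: even_period_def)
  then show ?thesis
    unfolding U_val_def alt_sum_eq[OF s] by (simp add: preperiod_end_def)
qed

lemma neg_sum_eq:
  assumes "neg_coeff z = periodic_seq cs ds"
  shows "of_int (neg_sum z (length cs + i)) = C_const cs + (\<Sum>j=1..i. 3 - of_int (per ds j))"
proof (induction i)
  case 0
  show ?case unfolding neg_sum_def C_const_def using assms by (simp add: periodic_seq_def)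
next
  case (Suc i)
  then show ?case by (simp add: neg_sum_def assms periodic_seq_add per_Suc)
qed

lemma V_val_eq:
  assumes s: "neg_coeff z = periodic_seq cs ds" and i: "i \<in> {1..length ds}"
  shows "V_val z cs ds i = of_int (neg_sum z (length cs + i)) + z - back_neg ds i - 3"
proof -
  have "1 / v_val ds i = back_neg ds i"
    unfolding v_val_def back_neg_def using i by (subst periodic_reversed_block) auto
  then show ?thesis unfolding V_val_def neg_sum_eq[OF s] by simp
qed

lemma reg_period_pos:
  assumes "z \<notin> \<rat>" "reg_coeff z = periodic_seq as bs"
  shows "\<forall>b\<in>set bs. b \<ge> 1"
proof
  fix b assume "b \<in> set bs"
  then obtain k where k: "k < length bs" "b = bs ! k" by (auto simp: in_set_conv_nth)
  \<comment> \<open>Looking one period later avoids index 0, whose digit has no a priori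
    sign.\<close>
  then have "b = reg_coeff z (length as + (k + length bs))"
    using assms(2) periodic_seq_add[of as bs "k + length bs"] by simp
  moreover have "length as + (k + length bs) = Suc (length as + (k + length bs) - 1)"
    using k(1) by simp
  ultimately show "b \<ge> 1" using reg_coeff_pos[OF assms(1)] by metis
qed

lemma neg_period_ge_2:
  assumes "z \<notin> \<rat>" "neg_coeff z = periodic_seq cs ds"
  shows "\<forall>d\<in>set ds. d \<ge> 2"
proof
  fix d assume "d \<in> set ds"
  then obtain k where k: "k < length ds" "d = ds ! k" by (auto simp: in_set_conv_nth)
  then have "d = neg_coeff z (length cs + (k + length ds))"
    using assms(2) periodic_seq_add[of cs ds "k + length ds"] by simp
  moreover have "length cs + (k + length ds) > 0" using k(1) by linarith
  ultimately show "d \<ge> 2" using neg_coeff_ge_2[OF assms(1)] by metis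
qed

text \<open>The reversed fractions are reindexed by positions in the expansions of \<open>z\<close>.
  Below the preperiod the subtraction truncates to 0; the bounds still hold there, and the
  recursions are needed only beyond it.\<close>

lemma back_sum_1:
  assumes z: "z \<notin> \<rat>" and a: "reg_coeff z = periodic_seq as bs" "bs \<noteq> []"
    and c: "neg_coeff z = periodic_seq cs ds" "ds \<noteq> []"
    and n: "n > 0" "2 * n \<ge> length as" "block_start z n \<ge> length cs"
  shows "back_reg bs (2 * n - length as) + back_neg ds (block_start z n - length cs) = 1"
proof (rule reversed_values_sum_1[where x = "\<lambda>K. back_reg bs (K - length as)"
      and y = "\<lambda>N. back_neg ds (N - length cs)" and k = "length as" and r = "length cs"
      and l = "length bs" and m = "length ds"])
  note bs = a(2) reg_period_pos[OF z a(1)] and ds = c(2) neg_period_ge_2[OF z c(1)]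
  show "reg_coeff z (K + 2 * length bs) = reg_coeff z K" if "K \<ge> length as" for K
    unfolding a(1) using that by (intro periodic_seq_periodic) auto
  show "back_reg bs (Suc K - length as)
      = 1 / (of_int (reg_coeff z K) + back_reg bs (K - length as))" if "K \<ge> length as" for K
    using back_reg_Suc[OF bs, of "K - length as"] periodic_seq_add[of as bs "K - length as"] that
    by (simp add: a(1) Suc_diff_le)
  show "back_neg ds (Suc N - length cs)
      = 1 / (of_int (neg_coeff z N) - back_neg ds (N - length cs))" if "N \<ge> length cs" for N
    using back_neg_Suc[OF ds, of "N - length cs"] periodic_seq_add[of cs ds "N - length cs"] that
    by (simp add: c(1) Suc_diff_le)
  show "back_reg bs (K + 2 * length bs - length as) = back_reg bs (K - length as)"
    if "K \<ge> length as" for K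
    using eventually_periodic_mult[of 0 "back_reg bs" "length bs" "K - length as" 2]
      back_reg_add_length[of bs] that by simp
  show "back_neg ds (N + length ds - length cs) = back_neg ds (N - length cs)"
    if "N \<ge> length cs" for N
    using back_neg_add_length[of ds "N - length cs"] that by simp
  show "0 < back_reg bs (K - length as)" for K by (rule back_reg_bounds(1)[OF bs])
  show "0 < back_neg ds (N - length cs)" "back_neg ds (N - length cs) \<le> 1" for N
    by (rule back_neg_bounds[OF ds])+
qed (use assms in auto)

theorem theorem4:
  fixes z :: real and as bs cs ds :: "int list"
  assumes "quadratic_irrational z"
    and "shortest_periodic_form (reg_coeff z) as bs"
    and "shortest_periodic_form (neg_coeff z) cs ds"
    and "B_const as bs = 0"
  shows "(\<forall>i\<in>{1..length ds}. per ds (i + 1) \<ge> 3 \<longrightarrow>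
            (\<exists>h\<in>{1..even_period bs}.
               odd (preperiod_end as + int h) \<and> V_val z cs ds i = U_val z as bs h)) \<and>
         (\<forall>h\<in>{1..even_period bs}. even (preperiod_end as + int h) \<longrightarrow>
            (\<forall>i\<in>{1..length ds}. U_val z as bs h \<noteq> V_val z cs ds i))"
proof (intro conjI ballI impI)
  have z: "z \<notin> \<rat>" using assms(1) by (simp add: quadratic_irrational_def)
  have a: "reg_coeff z = periodic_seq as bs" "bs \<noteq> []"
    and c: "neg_coeff z = periodic_seq cs ds" "ds \<noteq> []"
    using assms(2,3) by (simp_all add: shortest_periodic_form_def)
  note bs = a(2) reg_period_pos[OF z a(1)] and ds = c(2) neg_period_ge_2[OF z c(1)]
  define L where "L = even_period bs"
  have L: "even L" "length bs dvd L" "L > 0" using a(2) by (auto simp: L_def even_period_def)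
  {
    fix i assume i: "i \<in> {1..length ds}" and d: "per ds (i + 1) \<ge> 3"
    define N where "N = length cs + i"
    have "neg_sum z (N + t * length ds) = neg_sum z N" for t
    proof (rule neg_sum_periodic[OF z, where k = "length as" and l = "L div 2" and r = "length cs"])
      show "reg_coeff z (K + 2 * (L div 2)) = reg_coeff z K" if "K \<ge> length as" for K
        using L periodic_seq_periodic[OF L(2) that] by (simp add: a(1))
      show "alt_sum z (K + 2 * (L div 2)) = alt_sum z K" if "K \<ge> length as" for K
        using L alt_sum_periodic[OF a(1) assms(4) that, of 1] by (simp add: L_def)
      show "neg_coeff z (N + length ds) = neg_coeff z N" if "N \<ge> length cs" for N
        using periodic_seq_periodic[of ds "length ds" cs N] that by (simp add: c(1))
    qed (use L c in \<open>auto simp: N_def\<close>)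
    moreover have "back_neg ds (i + t * length ds) = back_neg ds i" for t
      using eventually_periodic_mult[of 0 "back_neg ds"] back_neg_add_length[of ds] by simp
    ultimately have V: "V_val z cs ds i
        = of_int (neg_sum z (N + t * length ds)) + z - back_neg ds (i + t * length ds) - 3" for t
      unfolding V_val_eq[OF c(1) i] N_def by simp
    \<comment> \<open>Moving \<open>i\<close> by \<open>M\<close> periods leaves
      \<open>V_val\<close> unchanged and forces the block number \<open>n\<close> beyond
      \<open>length as + 1\<close>, hence the regular index \<open>2 * n\<close> beyond the
      preperiod.\<close>
    define M where "M = block_start z (length as + 1)"
    define N' where "N' = N + M * length ds"
    \<comment> \<open>Periods count from 1, so position \<open>length cs + i\<close> carries the
      digit with index \<open>i + 1\<close>.\<close>
    have "neg_coeff z N' = per ds (i + 1)"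
      using periodic_seq_add[of cs ds "i + M * length ds"] per_Suc[of ds i]
      by (simp add: c(1) N'_def N_def add.assoc)
    then obtain n where n: "N' = block_start z n"
      using neg_coeff_ge_3_imp_block_start[OF z] d by metis
    have "M \<le> M * length ds" using c(2) by (cases ds) auto
    then have "block_start z (length as + 1) < block_start z n"
      using i unfolding n[symmetric] N'_def N_def M_def[symmetric] atLeastAtMost_iff by linarith
    then have n2: "length as + 1 < n"
      by (simp only: strict_mono_less[OF block_start_strict_mono[OF z]])
    define h0 where "h0 = 2 * n - length as"
    have h0: "h0 \<ge> 1" "length as + h0 = 2 * n" using n2 by (auto simp: h0_def)
    have "back_reg bs h0 + back_neg ds (N' - length cs) = 1"
      unfolding h0_def n by (rule back_sum_1[OF z a c]) (use n2 n in \<open>auto simp: N'_def N_def\<close>)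
    moreover have "neg_sum z N' = alt_sum z (2 * n) + 1"
      unfolding n using neg_sum_block_start[OF z, of n] n2 by simp
    moreover have "V_val z cs ds i = of_int (neg_sum z N') + z - back_neg ds (N' - length cs) - 3"
      using V[of M] by (simp add: N'_def N_def add.assoc)
    \<comment> \<open>The offset 1 of the digit sums and \<open>back_neg = 1 - back_reg\<close>
      combine: \<open>1 - back_neg = back_reg\<close>.\<close>
    ultimately have V': "V_val z cs ds i = of_int (alt_sum z (length as + h0)) + (z + back_reg bs h0 - 3)"
      using h0 by simp
    \<comment> \<open>The representative of \<open>h0\<close> modulo \<open>L\<close> in
      \<open>1..L\<close> instead of \<open>0..L-1\<close>; \<open>L\<close> is even, so the parity
      is kept.\<close>
    define h where "h = (h0 - 1) mod L + 1"
    define t where "t = (h0 - 1) div L"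
    have ht: "h0 = h + t * L"
      using h0(1) div_mult_mod_eq[of "h0 - 1" L] by (simp add: h_def t_def)
    have h: "h \<in> {1..even_period bs}"
      using L(3) mod_less_divisor[of L "h0 - 1"] by (simp add: h_def L_def Suc_leI)
    obtain e where e: "L = e * length bs" using L(2) by (metis dvd_def mult.commute)
    have "back_reg bs h0 = back_reg bs h"
      using eventually_periodic_mult[of 0 "back_reg bs" "length bs" h "t * e"] back_reg_add_length[of bs]
      by (simp add: ht e mult.assoc)
    moreover have "alt_sum z (length as + h0) = alt_sum z (length as + h)"
      using alt_sum_periodic[OF a(1) assms(4), of "length as + h" t] by (simp add: ht L_def add.assoc)
    moreover have even: "even (length as + h)"
      using h0(2) L(1) by (metis ht add.assoc dvd_add_left_iff dvd_mult dvd_triv_left)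
    ultimately have "V_val z cs ds i = U_val z as bs h"
      unfolding V' U_val_eq[OF a h] by simp
    then show "\<exists>h\<in>{1..even_period bs}.
        odd (preperiod_end as + int h) \<and> V_val z cs ds i = U_val z as bs h"
      using h even by (intro bexI[of _ h]) (auto simp: preperiod_end_def)
  }
  {
    fix h i
    assume h: "h \<in> {1..even_period bs}" "even (preperiod_end as + int h)" and i: "i \<in> {1..length ds}"
    have odd: "odd (length as + h)" using h(2) by (auto simp: preperiod_end_def)
    show "U_val z as bs h \<noteq> V_val z cs ds i"
    proof
      assume "U_val z as bs h = V_val z cs ds i"
      then have "back_reg bs h - back_neg ds i
          = of_int (alt_sum z (length as + h) - neg_sum z (length cs + i) + 3)"
        unfolding U_val_eq[OF a h(1)] V_val_eq[OF c(1) i] using odd by simp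
      \<comment> \<open>The values lie in (0,1) and (0,1], so their difference, an integer, can only
        be 0.\<close>
      moreover have "\<bar>back_reg bs h - back_neg ds i\<bar> < 1"
        using back_reg_bounds[OF bs, of h] back_neg_bounds[OF ds, of i] by linarith
      ultimately have "back_reg bs h - back_neg ds i = 0"
        by (smt (verit) of_int_less_1_iff of_int_minus of_int_0)
      then show False using back_reg_neq_back_neg[OF bs ds] by simp
    qed
  }
qed

end
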